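(* Let $D_T$ be a regular $s^{n-k}$ design containing the null treatment (the zero row), with no main effect aliased with another main effect (i.e. $A_{1,0}=A_{2,0}=0$). Then $D_T$ can be partitioned into the maximal number $s^{n-k-1}$ of blocks as an RME design if and only if $D_T$ contains a row none of whose entries is zero.
   Context: Let $s$ be a prime power, $GF(s)$ the field with $s$ elements, and $V_m$ the space of row vectors of length $m$ over $GF(s)$. Let $n\ge1$, $k\ge0$ be integers with $n-k\ge1$. A regular $s^{n-k}$ design containing the null treatment is the $s^{n-k}\times n$ matrix $D_T$ whose rows are the vectors $uT$, $u\in V_{n-k}$, where $T$ is an $(n-k)\times n$ matrix over $GF(s)$ of full row rank (so the rows form an $[n,n-k]$ linear code). With $wt$ the Hamming weight, $A_{i,0}=(s-1)^{-1}\#\{w\in V_n: Tw'=0,\ wt(w)=i\}$; thus $A_{1,0}=A_{2,0}=0$ means that the columns of $T$ are nonzero and pairwise non-proportional. A partition of $D_T$ into $s^p$ blocks is given by an $(n-k)\times p$ matrix $B$ over $GF(s)$ of full column rank: the blocks are the sets $\{uT:u\in V_{n-k},\ uB=v\}$, one for each $v\in V_p$ (when $p=0$ there is just one block). The resulting regular $(s^{n-k}:s^p)$ design is a regular main effect (RME) design if no main effect is aliased with another main effect or confounded with a block effect, i.e. the columns of $T$ are nonzero, pairwise non-proportional, and none of them lies in the column space of $B$. "$D_T$ can be partitioned into $s^{n-k-1}$ blocks as an RME design" means that such a $B$ with $p=n-k-1$ exists for which the resulting design is RME. *)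

theory Defs
  imports "Jordan_Normal_Form.DL_Rank" "HOL-Library.Cardinality"
begin

(* The field GF(s) is a type 'a of sort {field, finite}, with s = CARD('a); V_m is carrier_vec m.
   The vector type does not distinguish rows from columns. *)

definition vec_mult_mat :: "'a::semiring_0 vec \<Rightarrow> 'a mat \<Rightarrow> 'a vec" (infixl "\<^sub>v*" 70)
  where "u \<^sub>v* M = M\<^sup>T *\<^sub>v u"

definition full_row_rank :: "'a::field mat \<Rightarrow> bool"
  where "full_row_rank M \<longleftrightarrow> vec_space.rank (dim_col M) M\<^sup>T = dim_row M"

definition full_col_rank :: "'a::field mat \<Rightarrow> bool"
  where "full_col_rank M \<longleftrightarrow> vec_space.rank (dim_row M) M = dim_col M"

definition column_space :: "'a::field mat \<Rightarrow> 'a vec set"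
  where "column_space M = vec_space.col_space (dim_row M) M"

(* D_T is represented by the set of its rows; for T of full row rank they are pairwise distinct. *)
definition design :: "'a::field mat \<Rightarrow> 'a vec set"
  where "design T = {u \<^sub>v* T |u. u \<in> carrier_vec (dim_row T)}"

definition wt :: "'a::zero vec \<Rightarrow> nat"
  where "wt w = card {i. i < dim_vec w \<and> w $ i \<noteq> 0}"

(* The number A_{i,0}. *)
definition A0 :: "'a::{field,finite} mat \<Rightarrow> nat \<Rightarrow> rat"
  where "A0 T i =
    of_nat (card {w \<in> carrier_vec (dim_col T). T *\<^sub>v w = 0\<^sub>v (dim_row T) \<and> wt w = i})
      / (of_nat CARD('a) - 1)"

definition block :: "'a::field mat \<Rightarrow> 'a mat \<Rightarrow> 'a vec \<Rightarrow> 'a vec set"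
  where "block T B v = {u \<^sub>v* T |u. u \<in> carrier_vec (dim_row T) \<and> u \<^sub>v* B = v}"

definition blocks :: "'a::field mat \<Rightarrow> 'a mat \<Rightarrow> 'a vec set set"
  where "blocks T B = block T B ` carrier_vec (dim_col B)"

definition rme_design :: "'a::field mat \<Rightarrow> 'a mat \<Rightarrow> bool"
  where "rme_design T B \<longleftrightarrow>
    (\<forall>j < dim_col T. col T j \<noteq> 0\<^sub>v (dim_row T)) \<and>
    (\<forall>i < dim_col T. \<forall>j < dim_col T. i \<noteq> j \<longrightarrow> \<not> (\<exists>c. col T i = c \<cdot>\<^sub>v col T j)) \<and>
    (\<forall>j < dim_col T. col T j \<notin> column_space B)"

definition rme_partition :: "'a::{field,finite} mat \<Rightarrow> nat \<Rightarrow> 'a vec set set \<Rightarrow> bool"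
  where "rme_partition T p P \<longleftrightarrow>
    (\<exists>B \<in> carrier_mat (dim_row T) p. full_col_rank B \<and> P = blocks T B \<and> rme_design T B)"

lemma full_col_rank_column_space:
  fixes B :: "'a::field mat"
  assumes "full_col_rank B" and ge: "dim_row B \<le> dim_col B"
  shows "column_space B = carrier_vec (dim_row B)"
proof -
  interpret vec_space "TYPE('a)" "dim_row B" .
  have sub: "set (cols B) \<subseteq> carrier_vec (dim_row B)"
    using cols_dim by blast
  have "lin_indpt {}" by (simp add: lin_dep_def)
  then obtain S where S: "maximal S (\<lambda>T. T \<subseteq> set (cols B) \<and> lin_indpt T)" "finite S"
    using maximal_exists_superset[of "set (cols B)" "\<lambda>T. T \<subseteq> set (cols B) \<and> lin_indpt T" "{}"]
    by auto
  have li: "S \<subseteq> set (cols B)" "lin_indpt S"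
    using S(1) by (auto simp: maximal_def)
  have "card S = dim_col B"
    using rank_card_indpt[OF _ S(1), of "dim_col B"] assms(1) by (simp add: full_col_rank_def)
  then have "card S \<ge> dim" using ge dim_is_n by simp
  then have "basis S"
    using dim_li_is_basis[of S] S(2) li subset_trans[OF li(1) sub] by auto
  then have "span S = carrier_vec (dim_row B)" by (simp add: basis_def)
  moreover have "span S \<subseteq> span (set (cols B))" using li(1) by (rule span_is_monotone)
  moreover have "span (set (cols B)) \<subseteq> carrier_vec (dim_row B)"
    using span_is_subset2[of "set (cols B)"] sub by simp
  ultimately show ?thesis unfolding column_space_def col_space_def by blast
qed

(* The number of blocks s^(n - k - 1) is the largest one possible. *)
lemma rme_partition_maximal:
  assumes "T \<in> carrier_mat m n" and "1 \<le> n" and "rme_partition T p P"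
  shows "p \<le> m - 1"
proof (rule ccontr)
  assume "\<not> p \<le> m - 1"
  then have "m \<le> p" by simp
  from assms obtain B where B: "B \<in> carrier_mat m p" "full_col_rank B" "rme_design T B"
    by (auto simp: rme_partition_def)
  have "column_space B = carrier_vec m"
    using full_col_rank_column_space[OF B(2)] B(1) \<open>m \<le> p\<close> by auto
  moreover have "col T 0 \<in> carrier_vec m" "col T 0 \<notin> column_space B"
    using assms B(3) by (auto simp: rme_design_def)
  ultimately show False by blast
qed

end

theory Submission
  imports Defs
begin

text \<open>
  The link between the two sides is a nonzero vector \<open>u\<close> of length \<open>m = n - k\<close>: its
  orthogonal complement is a hyperplane, and a column space of dimension \<open>m - 1\<close> is such a
  hyperplane. The entries of the row \<open>u \<^sub>v* T\<close> of the design are the scalar products of \<open>u\<close>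
  with the columns of \<open>T\<close>. So this row has no zero entry exactly when the hyperplane contains no
  column of \<open>T\<close>, which is what it means that no main effect is confounded with a block effect.

  A block matrix \<open>B\<close> with \<open>m - 1\<close> columns always has such a \<open>u\<close>
  (\<open>exists_nonzero_left_annihilator\<close>), and if \<open>B\<close> has full column rank its column space is the
  whole hyperplane (\<open>orthogonal_imp_in_column_space\<close>). Conversely each nonzero \<open>u\<close> arises from
  some \<open>B\<close> (\<open>exists_full_col_rank_annihilated\<close>), whose column space lies in the hyperplane
  (\<open>column_space_orthogonal\<close>). The remaining clauses of an RME design concern \<open>T\<close> alone and
  follow from the vanishing of \<open>A0 T 1\<close> and \<open>A0 T 2\<close>.
\<close>

section \<open>Column spaces that are hyperplanes\<close>

lemma vec_mult_mat_index:
  fixes M :: "'a::field mat"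
  assumes "u \<in> carrier_vec (dim_row M)" and "j < dim_col M"
  shows "(u \<^sub>v* M) $ j = u \<bullet> col M j"
  using assms comm_scalar_prod[of "col M j" "dim_row M" u]
  by (simp add: vec_mult_mat_def)

lemma vec_mult_mat_eq_0_imp_orthogonal:
  fixes M :: "'a::field mat"
  assumes "u \<in> carrier_vec (dim_row M)" and "u \<^sub>v* M = 0\<^sub>v (dim_col M)" and "x \<in> set (cols M)"
  shows "u \<bullet> x = 0"
  using assms by (auto simp: cols_def simp flip: vec_mult_mat_index)

lemma column_space_orthogonal:
  fixes B :: "'a::field mat"
  assumes u: "u \<in> carrier_vec (dim_row B)" and uB: "u \<^sub>v* B = 0\<^sub>v (dim_col B)"
    and t: "t \<in> column_space B"
  shows "u \<bullet> t = 0"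
proof -
  interpret vec_space "TYPE('a)" "dim_row B" .
  have "u \<in> orthogonal_complement (set (cols B))"
    using u vec_mult_mat_eq_0_imp_orthogonal[OF u uB] by (simp add: orthogonal_complement_def)
  then have "u \<in> orthogonal_complement (span (set (cols B)))"
    using in_orthogonal_complement_span cols_dim by blast
  then show ?thesis
    using t by (simp add: orthogonal_complement_def column_space_def col_space_def)
qed

text \<open>
  If \<open>t\<close> were outside the column space, then together with independent columns of \<open>B\<close> it would
  form a basis, and \<open>u\<close>, being orthogonal to this basis, would vanish.
\<close>

lemma orthogonal_imp_in_column_space:
  fixes B :: "'a::field mat"
  assumes rank: "full_col_rank B" and dim: "dim_row B \<le> Suc (dim_col B)"
    and u: "u \<in> carrier_vec (dim_row B)" "u \<noteq> 0\<^sub>v (dim_row B)"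
    and uB: "u \<^sub>v* B = 0\<^sub>v (dim_col B)"
    and t: "t \<in> carrier_vec (dim_row B)" "u \<bullet> t = 0"
  shows "t \<in> column_space B"
proof (rule ccontr)
  interpret vec_space "TYPE('a)" "dim_row B" .
  assume notin: "t \<notin> column_space B"
  have sub: "set (cols B) \<subseteq> carrier_vec (dim_row B)"
    using cols_dim by blast
  have "lin_indpt {}" by (simp add: lin_dep_def)
  then obtain S where S: "maximal S (\<lambda>T. T \<subseteq> set (cols B) \<and> lin_indpt T)" "finite S"
    using maximal_exists_superset[of "set (cols B)" "\<lambda>T. T \<subseteq> set (cols B) \<and> lin_indpt T" "{}"]
    by auto
  have li: "S \<subseteq> set (cols B)" "lin_indpt S"
    using S(1) by (auto simp: maximal_def)
  have Sc: "S \<subseteq> carrier_vec (dim_row B)" using li(1) sub by blast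
  have card_S: "card S = dim_col B"
    using rank_card_indpt[OF _ S(1), of "dim_col B"] rank by (simp add: full_col_rank_def)
  have "span S \<subseteq> column_space B"
    unfolding column_space_def col_space_def using li(1) by (rule span_is_monotone)
  then have t_span: "t \<notin> span S" using notin by blast
  then have t_S: "t \<notin> S" using in_own_span[of S] Sc by auto
  have "lin_indpt (S \<union> {t})"
    using lin_dep_iff_in_span[of S t] Sc li(2) t(1) t_S t_span by auto
  moreover have "card (S \<union> {t}) \<ge> dim"
    using card_S t_S S(2) dim dim_is_n by simp
  ultimately have "basis (S \<union> {t})"
    using dim_li_is_basis[of "S \<union> {t}"] S(2) Sc t(1) by auto
  then have span: "span (S \<union> {t}) = carrier_vec (dim_row B)" by (simp add: basis_def)
  have "u \<in> orthogonal_complement (S \<union> {t})"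
    using vec_mult_mat_eq_0_imp_orthogonal[OF u(1) uB] li(1) u(1) t(2)
    by (auto simp: orthogonal_complement_def)
  then have "u \<in> orthogonal_complement (carrier_vec (dim_row B))"
    using in_orthogonal_complement_span[of "S \<union> {t}"] Sc t(1) unfolding span by simp
  then have "u \<bullet> unit_vec (dim_row B) i = 0" for i
    by (simp add: orthogonal_complement_def)
  then have "u $ i = 0" if "i < dim_row B" for i
    using that scalar_prod_right_unit[OF that, of u] by simp
  then have "u = 0\<^sub>v (dim_row B)"
    using u(1) by (intro eq_vecI) auto
  then show False using u(2) by simp
qed

text \<open>
  A homogeneous system with fewer equations than unknowns has a nontrivial solution: zero rows
  turn the transposed matrix into a singular square one.
\<close>

lemma exists_nonzero_left_annihilator:
  fixes B :: "'a::field mat"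
  assumes "dim_col B < dim_row B"
  obtains u where "u \<in> carrier_vec (dim_row B)" "u \<noteq> 0\<^sub>v (dim_row B)" "u \<^sub>v* B = 0\<^sub>v (dim_col B)"
proof -
  let ?m = "dim_row B"
  let ?c = "\<lambda>i. if i < dim_col B then col B i else 0\<^sub>v ?m"
  define M where "M = mat\<^sub>r ?m ?m (\<lambda>i. if i = dim_col B then 0\<^sub>v ?m else ?c i)"
  have M: "M \<in> carrier_mat ?m ?m" by (simp add: M_def)
  have "det M = 0" unfolding M_def using assms by (intro det_row_0) auto
  then obtain u where u: "u \<in> carrier_vec ?m" "u \<noteq> 0\<^sub>v ?m" "M *\<^sub>v u = 0\<^sub>v ?m"
    using det_0_iff_vec_prod_zero_field[OF M] by blast
  have "u \<^sub>v* B = 0\<^sub>v (dim_col B)"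
  proof (rule eq_vecI)
    fix j assume "j < dim_vec (0\<^sub>v (dim_col B) :: 'a vec)"
    then have j: "j < dim_col B" by simp
    have "row M j = col B j" unfolding M_def using j assms by (intro eq_vecI) auto
    moreover have "(M *\<^sub>v u) $ j = 0" using u(3) j assms by simp
    ultimately have "col B j \<bullet> u = 0" using j assms M by simp
    then show "(u \<^sub>v* B) $ j = 0\<^sub>v (dim_col B) $ j"
      using j by (simp add: vec_mult_mat_def)
  qed (simp add: vec_mult_mat_def)
  then show thesis using that u by blast
qed

text \<open>
  Pick a nonzero entry \<open>u $ i\<close>. For each other position \<open>l\<close>, the unit vector at \<open>l\<close> can be
  corrected at position \<open>i\<close> to become orthogonal to \<open>u\<close>. These vectors are independent because
  deleting position \<open>i\<close> leaves the identity matrix.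
\<close>

lemma exists_full_col_rank_annihilated:
  fixes u :: "'a::field vec"
  assumes u: "u \<in> carrier_vec m" "u \<noteq> 0\<^sub>v m"
  obtains B where "B \<in> carrier_mat m (m - 1)" "full_col_rank B" "u \<^sub>v* B = 0\<^sub>v (m - 1)"
proof -
  interpret vec_space "TYPE('a)" m .
  obtain i where i: "i < m" "u $ i \<noteq> 0"
    using u by (auto simp: vec_eq_iff)
  \<comment> \<open>\<open>insert_index i\<close> enumerates the positions other than \<open>i\<close>.\<close>
  define B where "B = mat m (m - 1)
    (\<lambda>(l, c). if l = i then - u $ insert_index i c / u $ i
              else if l = insert_index i c then 1 else 0)"
  have B: "B \<in> carrier_mat m (m - 1)" by (simp add: B_def)
  have ins: "insert_index i c < m" if "c < m - 1" for c
    using that by (auto simp: insert_index_def)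
  have B_ins: "B $$ (insert_index i c, c') = (if c = c' then 1 else 0)"
    if "c < m - 1" "c' < m - 1" for c c'
    using that ins inj_onD[OF insert_index_inj_on[of i UNIV], of c c'] by (auto simp: B_def)
  have dist: "distinct (cols B)"
    unfolding distinct_conv_nth
  proof (intro allI impI)
    fix c c' assume "c < length (cols B)" "c' < length (cols B)" and ne: "c \<noteq> c'"
    then have c: "c < m - 1" "c' < m - 1" using B by auto
    then have "col B c $ insert_index i c \<noteq> col B c' $ insert_index i c"
      using B_ins[of c c] B_ins[of c c'] ne ins B by simp
    then show "cols B ! c \<noteq> cols B ! c'" using c B by auto
  qed
  have inj: "w = 0\<^sub>v (m - 1)" if w: "w \<in> carrier_vec (m - 1)" and 0: "B *\<^sub>v w = 0\<^sub>v m" for w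
  proof (rule eq_vecI)
    fix c assume "c < dim_vec (0\<^sub>v (m - 1) :: 'a vec)"
    then have c: "c < m - 1" by simp
    have "row B (insert_index i c) = unit_vec (m - 1) c"
      using c B_ins ins B by (intro eq_vecI) auto
    moreover have "(B *\<^sub>v w) $ insert_index i c = 0" using 0 ins[OF c] by simp
    ultimately show "w $ c = 0\<^sub>v (m - 1) $ c"
      using c w ins[OF c] B by simp
  qed (use w in simp)
  have "lin_indpt (set (cols B))"
  proof
    assume "lin_dep (set (cols B))"
    then obtain w where "w \<in> carrier_vec (m - 1)" "w \<noteq> 0\<^sub>v (m - 1)" "B *\<^sub>v w = 0\<^sub>v m"
      using lin_depE[OF B _ dist] by blast
    then show False using inj by blast
  qed
  then have rank: "full_col_rank B"
    using lin_indpt_full_rank[OF B dist] B by (simp add: full_col_rank_def)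
  have "u \<^sub>v* B = 0\<^sub>v (m - 1)"
  proof (rule eq_vecI)
    fix c assume "c < dim_vec (0\<^sub>v (m - 1) :: 'a vec)"
    then have c: "c < m - 1" by simp
    let ?l = "insert_index i c"
    have "u \<bullet> col B c = (\<Sum>r\<in>{0..<m}. u $ r * B $$ (r, c))"
      using B c by (simp add: scalar_prod_def)
    also have "\<dots> = (\<Sum>r\<in>{i, ?l}. u $ r * B $$ (r, c))"
      using i ins[OF c] c by (intro sum.mono_neutral_right) (auto simp: B_def)
    also have "\<dots> = 0"
      using i c ins[OF c] not_sym[OF insert_index_exclude[of i c]] by (simp add: B_def)
    finally show "(u \<^sub>v* B) $ c = 0\<^sub>v (m - 1) $ c"
      using vec_mult_mat_index[of u B c] u B c by simp
  qed (use B in \<open>simp add: vec_mult_mat_def\<close>)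
  then show thesis using that B rank by blast
qed

section \<open>Aliasing of main effects\<close>

lemma finite_carrier_vec: "finite (carrier_vec n :: 'a::finite vec set)"
proof -
  have "carrier_vec n \<subseteq> vec_of_list ` {xs :: 'a list. set xs \<subseteq> UNIV \<and> length xs = n}"
  proof
    fix v :: "'a vec" assume "v \<in> carrier_vec n"
    then show "v \<in> vec_of_list ` {xs. set xs \<subseteq> UNIV \<and> length xs = n}"
      by (intro image_eqI[of _ _ "list_of_vec v"]) (auto simp: vec_list)
  qed
  then show ?thesis
    by (rule finite_subset) (rule finite_imageI[OF finite_lists_length_eq[OF finite]])
qed

lemma A0_eq_0_iff:
  fixes T :: "'a::{field,finite} mat"
  shows "A0 T i = 0 \<longleftrightarrow>
    (\<forall>w \<in> carrier_vec (dim_col T). T *\<^sub>v w = 0\<^sub>v (dim_row T) \<longrightarrow> wt w \<noteq> i)"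
proof -
  have "card {0, 1 :: 'a} \<le> CARD('a)" by (rule card_mono) auto
  then have "of_nat CARD('a) - 1 \<noteq> (0 :: rat)" by auto
  moreover have "finite {w \<in> carrier_vec (dim_col T). T *\<^sub>v w = 0\<^sub>v (dim_row T) \<and> wt w = i}"
    by (rule finite_subset[OF _ finite_carrier_vec]) auto
  ultimately show ?thesis by (auto simp: A0_def)
qed

lemma mult_mat_vec_unit_vec:
  fixes T :: "'a::field mat"
  assumes "j < dim_col T"
  shows "T *\<^sub>v unit_vec (dim_col T) j = col T j"
  using assms by (intro eq_vecI) auto

lemma A0_1_imp_col_nonzero:
  assumes "A0 T 1 = 0" and j: "j < dim_col T"
  shows "col T j \<noteq> 0\<^sub>v (dim_row T)"
proof
  assume "col T j = 0\<^sub>v (dim_row T)"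
  then have "T *\<^sub>v unit_vec (dim_col T) j = 0\<^sub>v (dim_row T)"
    using mult_mat_vec_unit_vec[OF j] by simp
  moreover have "{l. l < dim_col T \<and> unit_vec (dim_col T) j $ l \<noteq> (0 :: 'a)} = {j}"
    using j by (auto split: if_splits)
  then have "wt (unit_vec (dim_col T) j :: 'a vec) = 1" by (simp add: wt_def)
  ultimately show False using assms(1) by (auto simp: A0_eq_0_iff)
qed

text \<open>
  A proportionality of two columns is a word of weight 2 in the kernel of \<open>T\<close>, unless its factor
  is zero, and then a column vanishes.
\<close>

lemma A0_1_2_imp_cols_not_proportional:
  fixes T :: "'a::{field,finite} mat"
  assumes "A0 T 1 = 0" and "A0 T 2 = 0" and i: "i < dim_col T" and j: "j < dim_col T"
    and ne: "i \<noteq> j"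
  shows "col T i \<noteq> c \<cdot>\<^sub>v col T j"
proof
  assume eq: "col T i = c \<cdot>\<^sub>v col T j"
  let ?w = "unit_vec (dim_col T) i - c \<cdot>\<^sub>v unit_vec (dim_col T) j"
  have "c \<noteq> 0"
    using eq A0_1_imp_col_nonzero[OF assms(1) i] j by auto
  then have "{l. l < dim_col T \<and> ?w $ l \<noteq> 0} = {i, j}"
    using i j ne by (auto split: if_splits)
  then have "wt ?w = 2" using ne by (simp add: wt_def)
  moreover have "T *\<^sub>v ?w = col T i - c \<cdot>\<^sub>v col T j"
    using mult_mat_vec_unit_vec[OF i] mult_mat_vec_unit_vec[OF j]
    by (simp add: mult_minus_distrib_mat_vec[of T "dim_row T" "dim_col T"]
        mult_mat_vec[of T "dim_row T" "dim_col T"])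
  then have "T *\<^sub>v ?w = 0\<^sub>v (dim_row T)" using eq by simp
  ultimately show False using assms(2) by (auto simp: A0_eq_0_iff)
qed

section \<open>Maximal blocking\<close>

theorem theorem4:
  fixes T :: "'a::{field,finite} mat" and n k :: nat
  assumes "1 \<le> n" and "1 \<le> n - k"
    and "T \<in> carrier_mat (n - k) n" and "full_row_rank T"
    and "A0 T 1 = 0" and "A0 T 2 = 0"
  shows "(\<exists>P. rme_partition T (n - k - 1) P) \<longleftrightarrow> (\<exists>x \<in> design T. \<forall>j < n. x $ j \<noteq> 0)"
proof -
  define m where "m = n - k"
  have m: "1 \<le> m" and T: "dim_row T = m" "dim_col T = n"
    using assms by (auto simp: m_def)
  have "\<exists>x \<in> design T. \<forall>j < n. x $ j \<noteq> 0" if "rme_partition T (m - 1) P" for P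
  proof -
    from that obtain B where B: "B \<in> carrier_mat m (m - 1)" "full_col_rank B" "rme_design T B"
      by (auto simp: rme_partition_def T)
    then obtain u where u: "u \<in> carrier_vec m" "u \<noteq> 0\<^sub>v m" "u \<^sub>v* B = 0\<^sub>v (m - 1)"
      using exists_nonzero_left_annihilator[of B] m by auto
    have "(u \<^sub>v* T) $ j \<noteq> 0" if j: "j < n" for j
    proof
      assume "(u \<^sub>v* T) $ j = 0"
      then have "u \<bullet> col T j = 0" using vec_mult_mat_index[of u T j] u j T by simp
      moreover have "col T j \<in> carrier_vec m" using T by auto
      ultimately have "col T j \<in> column_space B"
        using orthogonal_imp_in_column_space[of B u "col T j"] B u by auto
      then show False using B(3) j T by (simp add: rme_design_def)
    qed
    moreover have "u \<^sub>v* T \<in> design T" using u T by (auto simp: design_def)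
    ultimately show ?thesis by blast
  qed
  moreover have "\<exists>P. rme_partition T (m - 1) P"
    if x: "x \<in> design T" "\<forall>j < n. x $ j \<noteq> 0" for x
  proof -
    from x(1) obtain u where u: "u \<in> carrier_vec m" "x = u \<^sub>v* T"
      by (auto simp: design_def T)
    have nz: "u \<bullet> col T j \<noteq> 0" if "j < n" for j
      using vec_mult_mat_index[of u T j] x(2) u T that by metis
    have "u \<noteq> 0\<^sub>v m"
      using nz[of 0] assms(1) T by auto
    then obtain B where B: "B \<in> carrier_mat m (m - 1)" "full_col_rank B" "u \<^sub>v* B = 0\<^sub>v (m - 1)"
      using exists_full_col_rank_annihilated u(1) by blast
    have "col T j \<notin> column_space B" if "j < n" for j
      using column_space_orthogonal[of u B "col T j"] B u nz that by auto
    then have "rme_design T B"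
      using A0_1_imp_col_nonzero[OF assms(5)] A0_1_2_imp_cols_not_proportional[OF assms(5,6)] T
      by (auto simp: rme_design_def)
    then show ?thesis using B T unfolding rme_partition_def by blast
  qed
  ultimately show ?thesis unfolding m_def by blast
qed

end
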